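(* Let $K$ be a field and let $F : K^n \to K^n$ be a polynomial map such that $F(p_1) = F(p_2) = \cdots = F(p_r)$ for distinct collinear points $p_1, \ldots, p_r \in K^n$, where $r\ge 1$ is an integer. If the characteristic of $K$ does not divide $r$, $r \ne 1$ and $r \ge \deg F$, then $\det \mathcal{J} F \notin K^{*}$.
   Context: A polynomial map $F : K^n \to K^n$ is a tuple $F = (F_1,\ldots,F_n)$ of polynomials $F_i \in K[x_1,\ldots,x_n]$ (identified with the tuple of polynomials, not merely the induced function); $\deg F = \max_i \deg F_i$ (total degree). Its Jacobian matrix is $\mathcal{J} F = \left(\frac{\partial F_i}{\partial x_j}\right)_{i,j}$ (formal partial derivatives). $K^* = K\setminus\{0\}$, so $\det \mathcal{J}F \notin K^*$ means that the polynomial $\det \mathcal{J} F$ is not a nonzero constant. Points are collinear if they lie on a common affine line in $K^n$. "The characteristic does not divide $r$" means that the image of $r$ in $K$ is nonzero. *)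

theory Defs
  imports "HOL-Analysis.Analysis" "HOL-Library.Poly_Mapping"
begin

text \<open>
  An element of \<open>('n, 'k) mvpoly\<close> is a formal polynomial over \<open>'k\<close> in variables indexed by
  \<open>'n\<close>: a finitely supported map from exponent vectors to coefficients, with the convolution
  product. A polynomial map is a vector of such polynomials, so two polynomial maps
  that induce the same function (over a finite field) may still differ.
\<close>

type_synonym ('n, 'k) mvpoly = "('n \<Rightarrow>\<^sub>0 nat) \<Rightarrow>\<^sub>0 'k"

type_synonym ('n, 'k) polymap = "(('n, 'k) mvpoly, 'n) vec"

definition mvconst :: "'k \<Rightarrow> ('n, 'k::zero) mvpoly" where
  "mvconst c = Poly_Mapping.single 0 c"

text \<open>The zero polynomial gets degree 0.\<close>

definition total_degree :: "('n::finite, 'k::zero) mvpoly \<Rightarrow> nat" where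
  "total_degree f =
    Max (insert 0 ((\<lambda>m. \<Sum>i\<in>UNIV. Poly_Mapping.lookup m i) ` Poly_Mapping.keys f))"

definition polymap_degree :: "('n::finite, 'k::zero) polymap \<Rightarrow> nat" where
  "polymap_degree F = Max (range (\<lambda>i. total_degree (F $ i)))"

definition eval_mvpoly :: "('n::finite, 'k::comm_semiring_1) mvpoly \<Rightarrow> 'k ^ 'n \<Rightarrow> 'k" where
  "eval_mvpoly f x =
    (\<Sum>m\<in>Poly_Mapping.keys f.
      Poly_Mapping.lookup f m * (\<Prod>i\<in>UNIV. (x $ i) ^ Poly_Mapping.lookup m i))"

definition eval_polymap :: "('n::finite, 'k::comm_semiring_1) polymap \<Rightarrow> 'k ^ 'n \<Rightarrow> 'k ^ 'n" where
  "eval_polymap F x = (\<chi> i. eval_mvpoly (F $ i) x)"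

text \<open>
  The subtraction of exponents is truncated, which is harmless: a monomial in which the
  variable \<open>j\<close> does not occur contributes the coefficient 0.
\<close>

definition partial_deriv :: "'n \<Rightarrow> ('n, 'k::comm_semiring_1) mvpoly \<Rightarrow> ('n, 'k) mvpoly" where
  "partial_deriv j f =
    (\<Sum>m\<in>Poly_Mapping.keys f.
      Poly_Mapping.single (m - Poly_Mapping.single j 1) 
        (of_nat (Poly_Mapping.lookup m j) * Poly_Mapping.lookup f m))"

definition jacobian_matrix :: "('n::finite, 'k::comm_ring_1) polymap \<Rightarrow> ('n, 'k) mvpoly ^ 'n ^ 'n" where
  "jacobian_matrix F = (\<chi> i j. partial_deriv j (F $ i))"

text \<open>
  The library's \<open>collinear\<close> is restricted to real vector spaces.
\<close>

definition affine_line :: "('k::field ^ 'n::finite) set \<Rightarrow> bool" where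
  "affine_line L \<longleftrightarrow> (\<exists>a v. v \<noteq> 0 \<and> L = range (\<lambda>t. a + t *s v))"

definition collinear_points :: "('k::field ^ 'n::finite) set \<Rightarrow> bool" where
  "collinear_points S \<longleftrightarrow> (\<exists>L. affine_line L \<and> S \<subseteq> L)"

end

theory Submission
  imports Defs "HOL-Computational_Algebra.Polynomial"
begin

text \<open>
  Restricting \<open>F\<close> to the line \<open>a + t v\<close> through the points gives univariate polynomials of
  degree at most \<open>r\<close> that take equal values at \<open>r\<close> parameters \<open>t\<^sub>i\<close>. Hence the restriction of
  \<open>F\<^sub>k\<close> is a constant plus a scalar multiple of \<open>g = \<Prod>i. (t - t\<^sub>i)\<close>, and by the chain rule
  \<open>g'\<close> divides every entry of \<open>JF(a + t v) v\<close> in \<open>K[t]\<close>. By Cramer's rule \<open>g'\<close> divides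
  \<open>det JF(a + t v) v\<^sub>k\<close> for every \<open>k\<close>. If the determinant were a nonzero constant, \<open>g'\<close> would
  be a unit, but its degree is \<open>r - 1 \<ge> 1\<close> because \<open>r \<noteq> 0\<close> in \<open>K\<close>.
\<close>

section \<open>Determinants over commutative rings\<close>

lemma det_ring_hom:
  fixes h :: "'a::comm_ring_1 \<Rightarrow> 'b::comm_ring_1" and A :: "'a ^ 'n ^ 'n"
  assumes add: "\<And>x y. h (x + y) = h x + h y"
    and mult: "\<And>x y. h (x * y) = h x * h y"
    and one: "h 1 = 1"
  shows "h (det A) = det (\<chi> i j. h (A $ i $ j))"
proof -
  have zero: "h 0 = 0"
    using add[of 0 0] by simp
  have minus: "h (- x) = - h x" for x
    using add[of x "- x"] zero by (simp add: eq_neg_iff_add_eq_0 add.commute)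
  have sum: "h (sum f S) = (\<Sum>x\<in>S. h (f x))" for f :: "('n \<Rightarrow> 'n) \<Rightarrow> 'a" and S
    by (induction S rule: infinite_finite_induct) (simp_all add: zero add)
  have prod: "h (prod f S) = (\<Prod>x\<in>S. h (f x))" for f :: "'n \<Rightarrow> 'a" and S
    by (induction S rule: infinite_finite_induct) (simp_all add: one mult)
  have sign: "h (of_int (sign q)) = of_int (sign q)" for q :: "'n \<Rightarrow> 'n"
    by (simp add: sign_def one minus)
  show ?thesis
    unfolding det_def by (simp add: sum mult prod sign)
qed

text \<open>By linearity in row \<open>k\<close>, each summand with \<open>j \<noteq> k\<close>
  gives a matrix in which row \<open>j\<close> occurs twice, hence determinant 0; only
  \<open>j = k\<close> survives. The index set \<open>S\<close> is arbitrary to allow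
  induction.\<close>

lemma det_replace_row_sum:
  fixes A :: "'a::comm_ring_1 ^ 'n ^ 'n"
  assumes "finite S"
  shows "det (\<chi> i. if i = k then \<Sum>j\<in>S. x j *s row j A else row i A)
    = (if k \<in> S then x k * det A else 0)"
  using assms
proof (induction S rule: finite_induct)
  case empty
  show ?case
    using det_row_0[of k "\<lambda>i. row i A"] by (simp cong: if_cong)
next
  case (insert j S)
  have "det (\<chi> i. if i = k then row j A else row i A) = (if j = k then det A else 0)"
  proof (cases "j = k")
    case True
    have "(\<chi> i. if i = k then row j A else row i A) = A"
      using True by (simp add: vec_eq_iff row_def)
    then show ?thesis
      using True by simp
  next
    case False
    then have "det (\<chi> i. if i = k then row j A else row i A) = 0"
      by (intro det_identical_rows[of k j]) (auto simp: row_def vec_eq_iff)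
    then show ?thesis
      using False by simp
  qed
  then have "det (\<chi> i. if i = k then x j *s row j A else row i A)
    = (if j = k then x k * det A else 0)"
    using det_row_mul[of k "x j" "\<lambda>i. row j A" "\<lambda>i. row i A"] by auto
  then show ?case
    using insert det_row_add[of k "\<lambda>i. x j *s row j A" "\<lambda>i. \<Sum>j\<in>S. x j *s row j A" "\<lambda>i. row i A"]
    by (auto cong: if_cong)
qed

text \<open>Cramer's rule without division: if \<open>A x = d y\<close>, replacing column
  \<open>k\<close> of \<open>A\<close> by \<open>A x\<close> multiplies the determinant by
  \<open>x k\<close>, and \<open>d\<close> factors out of the new column. Columns are treated as
  rows of the transpose.\<close>

lemma dvd_det_mult_if_dvd_mult_vec:
  fixes A :: "'a::comm_ring_1 ^ 'n ^ 'n"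
  assumes "\<And>i. d dvd (\<Sum>j\<in>UNIV. A $ i $ j * x j)"
  shows "d dvd x k * det A"
proof -
  define y where "y = (\<chi> i. SOME q. (\<Sum>j\<in>UNIV. A $ i $ j * x j) = d * q)"
  have y: "(\<Sum>j\<in>UNIV. A $ i $ j * x j) = d * y $ i" for i
    unfolding y_def using assms[of i] by (auto simp: dvd_def intro: someI)
  have "(\<Sum>j\<in>UNIV. x j *s row j (transpose A)) = d *s y"
    by (simp add: vec_eq_iff y[symmetric] row_def transpose_def mult.commute)
  then have "x k * det A
    = det (\<chi> i. if i = k then d *s y else row i (transpose A))"
    using det_replace_row_sum[of UNIV k x "transpose A"]
    by (simp add: det_transpose del: row_transpose cong: if_cong)
  then show ?thesis
    using det_row_mul[of k d "\<lambda>_. y" "\<lambda>i. row i (transpose A)"] by simp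
qed

section \<open>Restriction of polynomials to a line\<close>

lemma poly_mapping_sum_single:
  "f = (\<Sum>m\<in>Poly_Mapping.keys f. Poly_Mapping.single m (Poly_Mapping.lookup f m))"
  by (rule poly_mapping_eqI) (auto simp: lookup_sum lookup_single when_def in_keys_iff)

lemma smult_sum_right: "smult c (sum f S) = (\<Sum>x\<in>S. smult c (f x))"
  by (induction S rule: infinite_finite_induct) (simp_all add: smult_add_right)

definition line_monom :: "'k::comm_ring_1 ^ 'n::finite \<Rightarrow> 'k ^ 'n \<Rightarrow> ('n \<Rightarrow>\<^sub>0 nat) \<Rightarrow> 'k poly" where
  "line_monom a v m = (\<Prod>i\<in>UNIV. [:a $ i, v $ i:] ^ Poly_Mapping.lookup m i)"

text \<open>This is the substitution of \<open>a $ i + t * v $ i\<close> for the variables. Its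
  value is a formal polynomial in \<open>t\<close>, so that derivatives and degrees make sense over
  finite fields too.\<close>

definition restrict_line ::
    "'k::comm_ring_1 ^ 'n::finite \<Rightarrow> 'k ^ 'n \<Rightarrow> ('n, 'k) mvpoly \<Rightarrow> 'k poly" where
  "restrict_line a v f =
    (\<Sum>m\<in>Poly_Mapping.keys f. smult (Poly_Mapping.lookup f m) (line_monom a v m))"

lemma restrict_line_single [simp]:
  "restrict_line a v (Poly_Mapping.single m c) = smult c (line_monom a v m)"
  by (simp add: restrict_line_def)

lemma line_monom_0 [simp]: "line_monom a v 0 = 1"
  by (simp add: line_monom_def)

lemma line_monom_add: "line_monom a v (m + m') = line_monom a v m * line_monom a v m'"
  by (simp add: line_monom_def lookup_add power_add prod.distrib)

lemma restrict_line_0 [simp]: "restrict_line a v 0 = 0"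
  by (simp add: restrict_line_def)

lemma restrict_line_add: "restrict_line a v (f + g) = restrict_line a v f + restrict_line a v g"
  unfolding restrict_line_def
  by (rule setsum_keys_plus_distrib) (simp_all add: smult_add_left)

lemma restrict_line_sum: "restrict_line a v (sum f S) = (\<Sum>x\<in>S. restrict_line a v (f x))"
  by (induction S rule: infinite_finite_induct) (simp_all add: restrict_line_add)

text \<open>Expanding both factors into monomials reduces this to \<open>line_monom_add\<close>.
  Multiplicativity is what lets \<open>det_ring_hom\<close> move the restriction inside the
  determinant.\<close>

lemma restrict_line_mult: "restrict_line a v (f * g) = restrict_line a v f * restrict_line a v g"
proof -
  let ?s = "\<lambda>f m. Poly_Mapping.single m (Poly_Mapping.lookup f m)"
  have "f * g = (\<Sum>m\<in>Poly_Mapping.keys f. ?s f m) * (\<Sum>m\<in>Poly_Mapping.keys g. ?s g m)"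
    by (simp flip: poly_mapping_sum_single)
  also have "\<dots> = (\<Sum>m\<in>Poly_Mapping.keys f. \<Sum>m'\<in>Poly_Mapping.keys g. ?s f m * ?s g m')"
    by (rule sum_product)
  finally show ?thesis
    by (simp add: restrict_line_sum mult_single line_monom_add restrict_line_def[of a v f]
        restrict_line_def[of a v g] sum_product mult.commute)
qed

lemma restrict_line_1 [simp]: "restrict_line a v 1 = 1"
  by (simp flip: single_one)

lemma poly_restrict_line: "poly (restrict_line a v f) t = eval_mvpoly f (a + t *s v)"
  by (simp add: restrict_line_def line_monom_def eval_mvpoly_def poly_sum poly_prod)

lemma degree_line_monom_le:
  "degree (line_monom a v m) \<le> (\<Sum>i\<in>UNIV. Poly_Mapping.lookup m i)"
proof -
  have "degree ([:a $ i, v $ i:] ^ n) \<le> n" for i n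
    by (rule order.trans[OF degree_power_le]) simp
  then show ?thesis
    unfolding line_monom_def
    by (intro order.trans[OF degree_prod_sum_le] sum_mono) simp_all
qed

lemma degree_restrict_line_le: "degree (restrict_line a v f) \<le> total_degree f"
  unfolding restrict_line_def
proof (rule degree_sum_le)
  fix m assume m: "m \<in> Poly_Mapping.keys f"
  have "degree (smult (Poly_Mapping.lookup f m) (line_monom a v m))
      \<le> (\<Sum>i\<in>UNIV. Poly_Mapping.lookup m i)"
    using degree_smult_le degree_line_monom_le by (rule order.trans)
  also have "\<dots> \<le> total_degree f"
    unfolding total_degree_def using m by (intro Max_ge) auto
  finally show "degree (smult (Poly_Mapping.lookup f m) (line_monom a v m)) \<le> total_degree f" .
qed simp

lemma pderiv_line_monom:
  fixes a v :: "'k::field ^ 'n::finite"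
  shows "pderiv (line_monom a v m) = (\<Sum>j\<in>UNIV.
    smult (of_nat (Poly_Mapping.lookup m j) * v $ j) (line_monom a v (m - Poly_Mapping.single j 1)))"
proof -
  \<comment> \<open>Only the factor at \<open>j\<close> changes. If \<open>j\<close> does not occur
    in \<open>m\<close>, both truncated exponents are 0.\<close>
  have "line_monom a v (m - Poly_Mapping.single j 1)
    = [:a $ j, v $ j:] ^ (Poly_Mapping.lookup m j - 1)
      * (\<Prod>i\<in>UNIV - {j}. [:a $ i, v $ i:] ^ Poly_Mapping.lookup m i)" for j
    unfolding line_monom_def
    by (subst prod.remove[of UNIV j]) (auto simp: lookup_minus lookup_single intro!: prod.cong)
  then show ?thesis
    unfolding line_monom_def[of a v m] pderiv_prod
    by (intro sum.cong) (simp_all add: pderiv_power pderiv_pCons mult_ac)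
qed

text \<open>The chain rule, extended linearly from monomials. The constants \<open>[:v $ j:]\<close>
  give the right-hand side the matrix-vector shape of
  \<open>dvd_det_mult_if_dvd_mult_vec\<close>.\<close>

lemma pderiv_restrict_line:
  fixes a v :: "'k::field ^ 'n::finite"
  shows "pderiv (restrict_line a v f)
    = (\<Sum>j\<in>UNIV. restrict_line a v (partial_deriv j f) * [:v $ j:])"
proof -
  have "pderiv (restrict_line a v f) = (\<Sum>m\<in>Poly_Mapping.keys f. \<Sum>j\<in>UNIV.
    smult (Poly_Mapping.lookup f m * (of_nat (Poly_Mapping.lookup m j) * v $ j))
      (line_monom a v (m - Poly_Mapping.single j 1)))"
    by (simp add: restrict_line_def higher_pderiv_sum[of 1, simplified] pderiv_smult pderiv_line_monom smult_sum_right)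
  also have "\<dots> = (\<Sum>j\<in>UNIV. restrict_line a v (partial_deriv j f) * [:v $ j:])"
    by (subst sum.swap)
      (simp add: partial_deriv_def restrict_line_sum sum_distrib_right mult_ac smult_sum_right)
  finally show ?thesis .
qed

section \<open>Univariate polynomials constant on a finite set\<close>

lemma constant_on_set_imp_pderiv_eq:
  fixes f :: "'k::field poly"
  assumes T: "finite T" "T \<noteq> {}" and deg: "degree f \<le> card T"
    and const: "\<And>t. t \<in> T \<Longrightarrow> poly f t = c"
  shows "pderiv f = smult (coeff f (card T)) (pderiv (\<Prod>t\<in>T. [:- t, 1:]))"
proof -
  let ?g = "\<Prod>t\<in>T. [:- t, 1:]" and ?n = "card T"
  have degg: "degree ?g = ?n"
    by (subst degree_prod_eq_sum_degree) auto
  have "lead_coeff ?g = 1"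
    by (simp add: lead_coeff_prod)
  then have coeff: "coeff ?g ?n = 1"
    by (simp add: degg)
  have n: "?n > 0"
    using T by (simp add: card_gt_0_iff)
  \<comment> \<open>The difference of the two sides has degree below \<open>?n\<close> and vanishes
    at the \<open>?n\<close> points of \<open>T\<close>. Positivity of \<open>?n\<close> keeps
    \<open>c\<close> out of the top coefficient.\<close>
  have "f = [:c:] + smult (coeff f ?n) ?g"
  proof (rule poly_eqI_degree_lead_coeff[where A = T and n = ?n])
    show "coeff f ?n = coeff ([:c:] + smult (coeff f ?n) ?g) ?n"
      using n coeff by (cases ?n) simp_all
    show "degree ([:c:] + smult (coeff f ?n) ?g) \<le> ?n"
      using degg by (intro degree_add_le) (auto intro: order.trans[OF degree_smult_le])
    show "poly f t = poly ([:c:] + smult (coeff f ?n) ?g) t" if "t \<in> T" for t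
    proof -
      have "poly ?g t = 0"
        using that T by (auto simp: poly_prod)
      then show ?thesis
        using const[OF that] by simp
    qed
  qed (use deg in auto)
  then have "pderiv f = pderiv ([:c:] + smult (coeff f ?n) ?g)"
    by (rule arg_cong)
  then show ?thesis
    by (simp add: pderiv_add pderiv_smult pderiv_pCons)
qed

text \<open>The product is monic of degree \<open>card T\<close>, so the coefficient of its
  derivative in degree \<open>card T - 1\<close> is the image of \<open>card T\<close> in the
  field.\<close>

lemma degree_pderiv_prod_linear:
  fixes T :: "'k::field set"
  assumes "of_nat (card T) \<noteq> (0 :: 'k)"
  shows "degree (pderiv (\<Prod>t\<in>T. [:- t, 1:])) \<ge> card T - 1"
proof (rule le_degree)
  have "card T > 0"
    using assms by (cases "card T") auto
  moreover have "degree (\<Prod>t\<in>T. [:- t, 1:]) = card T"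
    by (subst degree_prod_eq_sum_degree) auto
  moreover have "lead_coeff (\<Prod>t\<in>T. [:- t, 1:]) = 1"
    by (simp add: lead_coeff_prod)
  ultimately show "coeff (pderiv (\<Prod>t\<in>T. [:- t, 1:])) (card T - 1) \<noteq> 0"
    using assms by (simp add: coeff_pderiv)
qed

theorem corollary2p4:
  fixes F :: "('n::finite, 'k::field) polymap"
    and r :: nat
    and p :: "nat \<Rightarrow> 'k ^ 'n"
  assumes "r \<ge> 1"
    and "inj_on p {1..r}"
    and "collinear_points (p ` {1..r})"
    and "\<And>i j. i \<in> {1..r} \<Longrightarrow> j \<in> {1..r} \<Longrightarrow> eval_polymap F (p i) = eval_polymap F (p j)"
    and "of_nat r \<noteq> (0 :: 'k)"
    and "r \<noteq> 1"
    and "r \<ge> polymap_degree F"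
  shows "\<not> (\<exists>c :: 'k. c \<noteq> 0 \<and> det (jacobian_matrix F) = mvconst c)"
proof
  assume "\<exists>c :: 'k. c \<noteq> 0 \<and> det (jacobian_matrix F) = mvconst c"
  then obtain c :: 'k where c: "c \<noteq> 0" "det (jacobian_matrix F) = mvconst c"
    by blast
  obtain a v where v: "v \<noteq> 0" and line: "p ` {1..r} \<subseteq> range (\<lambda>t. a + t *s v)"
    using assms(3) by (auto simp: collinear_points_def affine_line_def)
  then have "\<forall>i\<in>{1..r}. \<exists>s. p i = a + s *s v"
    by blast
  then obtain s where s: "\<And>i. i \<in> {1..r} \<Longrightarrow> p i = a + s i *s v"
    by metis
  define T where "T = s ` {1..r}"
  \<comment> \<open>Equal parameters would give equal points, so there are \<open>r\<close> distinct
    parameters.\<close>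
  have "inj_on s {1..r}"
    using assms(2) s by (metis inj_on_def)
  then have card: "card T = r"
    by (simp add: T_def card_image)
  have T: "finite T" "T \<noteq> {}"
    using assms(1) by (auto simp: T_def)
  define g where "g = (\<Prod>t\<in>T. [:- t, 1:])"
  let ?J = "\<chi> i j. restrict_line a v (jacobian_matrix F $ i $ j)"
  have dvd: "pderiv g dvd (\<Sum>j\<in>UNIV. ?J $ k $ j * [:v $ j:])" for k
  proof -
    have "total_degree (F $ k) \<le> r"
      using assms(7) unfolding polymap_degree_def by (meson Max_ge finite finite_imageI order.trans rangeI)
    then have deg: "degree (restrict_line a v (F $ k)) \<le> card T"
      using degree_restrict_line_le[of a v "F $ k"] card by simp
    have "poly (restrict_line a v (F $ k)) t = eval_mvpoly (F $ k) (p 1)" if "t \<in> T" for t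
    proof -
      obtain i where i: "i \<in> {1..r}" "t = s i"
        using \<open>t \<in> T\<close> by (auto simp: T_def)
      have "eval_polymap F (p i) $ k = eval_polymap F (p 1) $ k"
        using assms(1) assms(4)[of i 1] i by simp
      then show ?thesis
        using s i by (simp add: poly_restrict_line eval_polymap_def)
    qed
    then have "pderiv g dvd pderiv (restrict_line a v (F $ k))"
      using constant_on_set_imp_pderiv_eq[OF T deg] by (simp add: g_def dvd_smult)
    then show ?thesis
      by (simp add: pderiv_restrict_line jacobian_matrix_def)
  qed
  \<comment> \<open>Cramer's rule is applied at a nonzero coordinate of \<open>v\<close>, so that
    \<open>v $ k * c\<close> is nonzero and divisibility by \<open>pderiv g\<close> bounds its
    degree by 0.\<close>
  obtain k where k: "v $ k \<noteq> 0"
    using v by (auto simp: vec_eq_iff)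
  have "pderiv g dvd [:v $ k:] * det ?J"
    using dvd by (rule dvd_det_mult_if_dvd_mult_vec)
  also have "det ?J = restrict_line a v (det (jacobian_matrix F))"
    by (rule det_ring_hom[symmetric]) (simp_all add: restrict_line_add restrict_line_mult)
  also have "\<dots> = [:c:]"
    by (simp add: c mvconst_def)
  finally have "pderiv g dvd [:v $ k * c:]"
    by (simp add: mult.commute)
  then have "degree (pderiv g) \<le> degree [:v $ k * c:]"
    using k c(1) by (intro dvd_imp_degree_le) simp_all
  moreover have "degree (pderiv g) \<ge> r - 1"
    using degree_pderiv_prod_linear[of T] assms(5) card by (simp add: g_def)
  ultimately show False
    using assms(1,6) by simp
qed

end
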